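(* Let $X$ be a path-connected smooth manifold and let $Z\subset X$ be a submanifold of codimension $1$. Then $$\mathrm{Tcat}(X,Z)\leq \mathrm{TTC}(X,Z).$$
   Context: Smooth manifolds and submanifolds ($X$ and $Z$) are without boundary. $X^{[0,1]}$ is the space of all continuous paths $[0,1]\to X$ with the compact-open topology, and $e_2^X\colon X^{[0,1]}\to X\times X$ is $e_2^X(\gamma)=(\gamma(0),\gamma(1))$. Semi-transversality: a path $\Gamma\colon[0,1]\to X$ is semi-transversal to $Z$, written $\Gamma\pitchfork_s Z$, if whenever $t\in(0,1)$ and $\Gamma(t)\in Z$, then $\Gamma$ is smooth in $t$ and $\langle\Gamma'(t)\rangle+T_{\Gamma(t)}Z=T_{\Gamma(t)}X$ (equivalently, $\Gamma'(t)\notin T_{\Gamma(t)}Z$), where $\langle\Gamma'(t)\rangle$ is the subspace generated by $\Gamma'(t)$. No condition is imposed at $t=0,1$. Transversal topological complexity: $\mathrm{TTC}(X,Z)$ is the smallest positive integer $k$ for which $X\times X$ is covered by $k$ open subsets $U_1,\ldots,U_k$ such that for each $i$ there exists a continuous map $s_i\colon U_i\to X^{[0,1]}$ with $e_2^X\circ s_i$ equal to the inclusion $U_i\hookrightarrow X\times X$ and $s_i(x,y)\pitchfork_s Z$ for every $(x,y)\in U_i$; if no such $k$ exists, $\mathrm{TTC}(X,Z)=\infty$. Transversal LS category: $\mathrm{Tcat}(X,Z)$ is the smallest positive integer $k$ for which $X$ is covered by $k$ open subsets $U_1,\ldots,U_k$ such that for each $i$ there exists a continuous map $H\colon U_i\times[0,1]\to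 X$ with $H_0$ equal to the inclusion $U_i\hookrightarrow X$, $H_1$ constant, and $H(x,-)\pitchfork_s Z$ for every $x\in U_i$ (here $H_t=H(-,t)$); if no such $k$ exists, $\mathrm{Tcat}(X,Z)=\infty$. *)

theory Defs
  imports "HOL-Analysis.Analysis" "HOL-Library.Extended_Nat"
begin

section \<open>Smooth maps between open subsets of normed spaces\<close>

text \<open>Being \<open>k\<close> times continuously differentiable is expressed through iterated
  directional derivatives in constant directions. It is only used on open sets.\<close>

primrec Ck_on :: "nat \<Rightarrow> 'a::real_normed_vector set \<Rightarrow> ('a \<Rightarrow> 'b::real_normed_vector) \<Rightarrow> bool" where
  "Ck_on 0 S f \<longleftrightarrow> continuous_on S f"
| "Ck_on (Suc k) S f \<longleftrightarrow>
     (\<forall>x\<in>S. f differentiable (at x)) \<and> (\<forall>v. Ck_on k S (\<lambda>x. frechet_derivative f (at x) v))"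

definition smooth_on :: "'a::real_normed_vector set \<Rightarrow> ('a \<Rightarrow> 'b::real_normed_vector) \<Rightarrow> bool" where
  "smooth_on S f \<longleftrightarrow> (\<forall>k. Ck_on k S f)"


section \<open>Smooth manifolds and submanifolds\<close>

text \<open>A chart is a pair of its domain and a coordinate map; the values of the coordinate map
  outside the domain are irrelevant. The dimension of the manifold is \<open>DIM('e)\<close>.\<close>

type_synonym ('a, 'e) chart = "'a set \<times> ('a \<Rightarrow> 'e)"

definition is_chart :: "'a topology \<Rightarrow> ('a, 'e::euclidean_space) chart \<Rightarrow> bool" where
  "is_chart X c \<longleftrightarrow> (case c of (U, \<phi>) \<Rightarrow>
     openin X U \<and> open (\<phi> ` U) \<and> homeomorphic_map (subtopology X U) (top_of_set (\<phi> ` U)) \<phi>)"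

definition smooth_compat :: "('a, 'e::euclidean_space) chart \<Rightarrow> ('a, 'e) chart \<Rightarrow> bool" where
  "smooth_compat c d \<longleftrightarrow> (case c of (U, \<phi>) \<Rightarrow> case d of (V, \<psi>) \<Rightarrow>
     smooth_on (\<phi> ` (U \<inter> V)) (\<psi> \<circ> inv_into U \<phi>) \<and>
     smooth_on (\<psi> ` (U \<inter> V)) (\<phi> \<circ> inv_into V \<psi>))"

text \<open>The smooth structure \<open>A\<close> is a maximal smooth atlas.\<close>

definition smooth_manifold :: "'a topology \<Rightarrow> ('a, 'e::euclidean_space) chart set \<Rightarrow> bool" where
  "smooth_manifold X A \<longleftrightarrow>
     Hausdorff_space X \<and> second_countable X \<and>
     (\<forall>c\<in>A. is_chart X c) \<and>
     (\<Union>c\<in>A. fst c) = topspace X \<and>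
     (\<forall>c\<in>A. \<forall>d\<in>A. smooth_compat c d) \<and>
     (\<forall>c. is_chart X c \<and> (\<forall>d\<in>A. smooth_compat c d) \<longrightarrow> c \<in> A)"

text \<open>Embedded submanifolds of codimension \<open>m\<close>, given by slice charts. They need not be
  closed subsets.\<close>

definition submanifold ::
  "'a topology \<Rightarrow> ('a, 'e::euclidean_space) chart set \<Rightarrow> 'a set \<Rightarrow> nat \<Rightarrow> bool" where
  "submanifold X A Z m \<longleftrightarrow>
     Z \<subseteq> topspace X \<and>
     (\<forall>p\<in>Z. \<exists>(U, \<phi>)\<in>A. p \<in> U \<and>
        (\<exists>S. subspace S \<and> dim S + m = DIM('e) \<and> \<phi> ` (U \<inter> Z) = \<phi> ` U \<inter> S))"


section \<open>Tangent vectors\<close>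

text \<open>Smoothness of a curve at a parameter \<open>t\<close> means smoothness on some neighbourhood of \<open>t\<close>.\<close>

definition smooth_curve_at ::
  "('a, 'e::euclidean_space) chart set \<Rightarrow> (real \<Rightarrow> 'a) \<Rightarrow> real \<Rightarrow> bool" where
  "smooth_curve_at A \<gamma> t \<longleftrightarrow>
     (\<exists>(U, \<phi>)\<in>A. \<exists>J. open J \<and> t \<in> J \<and> \<gamma> ` J \<subseteq> U \<and> smooth_on J (\<phi> \<circ> \<gamma>))"

text \<open>A tangent vector at \<open>p\<close> is represented by the family of its coordinate vectors in all
  charts around \<open>p\<close>, extended by 0 to the charts whose domain does not contain \<open>p\<close>. Linear
  operations on tangent vectors are thus pointwise.\<close>

type_synonym ('a, 'e) tangent_vector = "('a, 'e) chart \<Rightarrow> 'e"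

definition velocity ::
  "('a, 'e::euclidean_space) chart set \<Rightarrow> (real \<Rightarrow> 'a) \<Rightarrow> real \<Rightarrow> ('a, 'e) tangent_vector" where
  "velocity A \<gamma> t = (\<lambda>c. if c \<in> A \<and> \<gamma> t \<in> fst c
                         then vector_derivative (snd c \<circ> \<gamma>) (at t) else 0)"

text \<open>\<open>tangent_space A Z p\<close> consists of the velocities of smooth curves through \<open>p\<close> that stay
  inside \<open>Z\<close>, for a submanifold \<open>Z\<close>; the case \<open>Z = topspace X\<close> is the tangent space of \<open>X\<close>.\<close>

definition tangent_space ::
  "('a, 'e::euclidean_space) chart set \<Rightarrow> 'a set \<Rightarrow> 'a \<Rightarrow> ('a, 'e) tangent_vector set" where
  "tangent_space A Z p =
     {velocity A \<gamma> 0 | \<gamma>. \<gamma> 0 = p \<and> smooth_curve_at A \<gamma> 0 \<and> (\<forall>\<^sub>F s in nhds 0. \<gamma> s \<in> Z)}"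

text \<open>Only the values of \<open>\<Gamma>\<close> on the unit interval matter, since \<open>t\<close> is an interior point.\<close>

definition semi_transversal ::
  "'a topology \<Rightarrow> ('a, 'e::euclidean_space) chart set \<Rightarrow> 'a set \<Rightarrow> (real \<Rightarrow> 'a) \<Rightarrow> bool" where
  "semi_transversal X A Z \<Gamma> \<longleftrightarrow>
     (\<forall>t\<in>{0<..<1}. \<Gamma> t \<in> Z \<longrightarrow>
        smooth_curve_at A \<Gamma> t \<and>
        {(\<lambda>c. r *\<^sub>R velocity A \<Gamma> t c + w c) | r w. w \<in> tangent_space A Z (\<Gamma> t)} =
          tangent_space A (topspace X) (\<Gamma> t))"


section \<open>The path space\<close>

text \<open>A path \<open>[0,1] \<rightarrow> X\<close> is represented by a function on the reals that is \<open>undefined\<close>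
  outside of \<open>[0,1]\<close>.\<close>

definition paths :: "'a topology \<Rightarrow> (real \<Rightarrow> 'a) set" where
  "paths X = {\<gamma> \<in> extensional {0..1}. pathin X \<gamma>}"

text \<open>The compact-open topology.\<close>

definition path_space :: "'a topology \<Rightarrow> (real \<Rightarrow> 'a) topology" where
  "path_space X = topology_generated_by
     {{\<gamma> \<in> paths X. \<gamma> ` K \<subseteq> V} | K V. compact K \<and> K \<subseteq> {0..1} \<and> openin X V}"

lemma topspace_path_space: "topspace (path_space X) = paths X"
proof -
  have "paths X \<in> {{\<gamma> \<in> paths X. \<gamma> ` K \<subseteq> V} | K V.
      compact K \<and> K \<subseteq> {0..1} \<and> openin X V}"
    by (rule CollectI, rule exI[of _ "{}"], rule exI[of _ "topspace X"]) auto
  then show ?thesis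
    unfolding path_space_def topology_generated_by_topspace by blast
qed

definition endpoints :: "(real \<Rightarrow> 'a) \<Rightarrow> 'a \<times> 'a" where
  "endpoints \<gamma> = (\<gamma> 0, \<gamma> 1)"


section \<open>Transversal topological complexity and transversal category\<close>

text \<open>Both invariants are infima in \<^typ>\<open>enat\<close>, so that they are \<open>\<infinity>\<close> if no suitable finite
  cover exists.\<close>

definition TTC ::
  "'a topology \<Rightarrow> ('a, 'e::euclidean_space) chart set \<Rightarrow> 'a set \<Rightarrow> enat" where
  "TTC X A Z = Inf (enat ` {k. 0 < k \<and>
     (\<exists>U. (\<Union>i<k. U i) = topspace (prod_topology X X) \<and>
        (\<forall>i<k. openin (prod_topology X X) (U i) \<and>
           (\<exists>s. continuous_map (subtopology (prod_topology X X) (U i)) (path_space X) s \<and>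
              (\<forall>z\<in>U i. endpoints (s z) = z \<and> semi_transversal X A Z (s z)))))})"

definition Tcat ::
  "'a topology \<Rightarrow> ('a, 'e::euclidean_space) chart set \<Rightarrow> 'a set \<Rightarrow> enat" where
  "Tcat X A Z = Inf (enat ` {k. 0 < k \<and>
     (\<exists>U. (\<Union>i<k. U i) = topspace X \<and>
        (\<forall>i<k. openin X (U i) \<and>
           (\<exists>H. continuous_map (prod_topology (subtopology X (U i)) (top_of_set {0..1})) X H \<and>
              (\<forall>x\<in>U i. H (x, 0) = x) \<and>
              (\<lambda>x. H (x, 1)) constant_on U i \<and>
              (\<forall>x\<in>U i. semi_transversal X A Z (\<lambda>t. H (x, t))))))})"

end

theory Submission
  imports Defs
begin

text \<open>Fix a base point \<open>y\<close>. A local section \<open>s\<close> of the path fibration over \<open>U\<close> restricts to the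
  slice of all \<open>x\<close> with \<open>(x, y) \<in> U\<close>, and by evaluation of paths it becomes a
  contraction \<open>(x, t) \<mapsto> s (x, y) t\<close> of that slice to \<open>y\<close> along the same, hence still
  semi-transversal, paths.\<close>

lemma openin_path_space_subbasic:
  assumes "compact K" "K \<subseteq> {0..1}" "openin X V"
  shows "openin (path_space X) {\<gamma> \<in> paths X. \<gamma> ` K \<subseteq> V}"
  unfolding path_space_def using assms by (intro topology_generated_by_Basis) blast

text \<open>The reason is local compactness of the unit interval: a path sending \<open>t\<close>
  into \<open>W\<close> sends a whole compact neighbourhood of \<open>t\<close> into
  \<open>W\<close>, which is a subbasic condition on paths. This turns a continuous family of paths
  into a jointly continuous homotopy.\<close>

lemma continuous_map_path_space_eval:
  "continuous_map (prod_topology (path_space X) (top_of_set {0..1})) X (\<lambda>(\<gamma>, t). \<gamma> t)"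
  unfolding continuous_map_def
proof (intro conjI allI impI)
  show "(\<lambda>(\<gamma>, t). \<gamma> t) \<in> topspace (prod_topology (path_space X) (top_of_set {0..1})) \<rightarrow> topspace X"
    by (auto simp: topspace_path_space paths_def pathin_def continuous_map_def Pi_iff)
  fix W assume W: "openin X W"
  let ?P = "{z \<in> topspace (prod_topology (path_space X) (top_of_set {0..1::real})).
    (case z of (\<gamma>, t) \<Rightarrow> \<gamma> t) \<in> W}"
  have "\<exists>N J. openin (path_space X) N \<and> openin (top_of_set {0..1::real}) J \<and>
      \<gamma> \<in> N \<and> t \<in> J \<and> N \<times> J \<subseteq> ?P" if z: "(\<gamma>, t) \<in> ?P" for \<gamma> t
  proof -
    from z have g: "\<gamma> \<in> paths X" and t: "t \<in> {0..1}" and gt: "\<gamma> t \<in> W"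
      by (auto simp: topspace_path_space)
    from g have "continuous_map (top_of_set {0..1}) X \<gamma>"
      by (simp add: paths_def pathin_def)
    then have "openin (top_of_set {0..1}) {r \<in> {0..1}. \<gamma> r \<in> W}"
      using W by (auto simp: continuous_map_def)
    \<comment> \<open>Two balls of the same radius are used: the closed one supplies the compact set
      defining \<open>?N\<close>, the open one the neighbourhood of \<open>t\<close> on which all
      paths in \<open>?N\<close> stay in \<open>W\<close>.\<close>
    then obtain e where e: "e > 0" "cball t e \<inter> {0..1} \<subseteq> {r \<in> {0..1}. \<gamma> r \<in> W}"
      using t gt by (auto simp: openin_contains_cball)
    let ?K = "cball t e \<inter> {0..1}"
    let ?N = "{\<gamma> \<in> paths X. \<gamma> ` ?K \<subseteq> W}"
    have "openin (path_space X) ?N"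
      using W by (intro openin_path_space_subbasic) (auto intro: compact_Int)
    moreover have "openin (top_of_set {0..1}) ({0..1} \<inter> ball t e)"
      by (auto intro: openin_open_Int)
    moreover have "?N \<times> ({0..1} \<inter> ball t e) \<subseteq> ?P"
      by (auto simp: topspace_path_space image_subset_iff)
    ultimately show ?thesis
      using g t e by (intro exI[of _ ?N] exI[of _ "{0..1} \<inter> ball t e"]) auto
  qed
  then show "openin (prod_topology (path_space X) (top_of_set {0..1})) ?P"
    unfolding openin_prod_topology_alt by blast
qed

theorem proposition2p12:
  fixes X :: "'a topology"
    and A :: "('a, 'e::euclidean_space) chart set"
    and Z :: "'a set"
  assumes "smooth_manifold X A"
    and "path_connected_space X"
    and "submanifold X A Z 1"
  shows "Tcat X A Z \<le> TTC X A Z"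
  unfolding Tcat_def TTC_def
\<comment> \<open>\<open>Inf\<close> is antitone, so it suffices that every \<open>k\<close>
  admissible for \<open>TTC\<close> is admissible for \<open>Tcat\<close>, with the same number of
  open sets.\<close>
proof (intro Inf_superset_mono image_mono subsetI CollectI, elim CollectE conjE exE, intro conjI)
  fix k :: nat and U :: "nat \<Rightarrow> ('a \<times> 'a) set"
  assume cov: "(\<Union>i<k. U i) = topspace (prod_topology X X)"
    and U: "\<forall>i<k. openin (prod_topology X X) (U i) \<and>
      (\<exists>s. continuous_map (subtopology (prod_topology X X) (U i)) (path_space X) s \<and>
        (\<forall>z\<in>U i. endpoints (s z) = z \<and> semi_transversal X A Z (s z)))"
  show "\<exists>V. (\<Union>i<k. V i) = topspace X \<and> (\<forall>i<k. openin X (V i) \<and>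
      (\<exists>H. continuous_map (prod_topology (subtopology X (V i)) (top_of_set {0..1})) X H \<and>
        (\<forall>x\<in>V i. H (x, 0) = x) \<and> (\<lambda>x. H (x, 1)) constant_on V i \<and>
        (\<forall>x\<in>V i. semi_transversal X A Z (\<lambda>t. H (x, t)))))"
  \<comment> \<open>The empty space also counts as path-connected, so a base point has to be secured
    first; without one, \<open>k\<close> empty sets form the cover.\<close>
  proof (cases "topspace X = {}")
    case True
    then show ?thesis
      by (intro exI[of _ "\<lambda>_. {}"]) (auto simp: constant_on_def continuous_map_def)
  next
    case False
    then obtain y where y: "y \<in> topspace X" by blast
    define V where "V i = {x \<in> topspace X. (x, y) \<in> U i}" for i
    have slice: "continuous_map X (prod_topology X X) (\<lambda>x. (x, y))"
      using y by (simp add: continuous_map_pairwise o_def)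
    have "(\<Union>i<k. V i) = topspace X"
      using cov y by (auto simp: V_def)
    moreover have "openin X (V i) \<and>
        (\<exists>H. continuous_map (prod_topology (subtopology X (V i)) (top_of_set {0..1})) X H \<and>
          (\<forall>x\<in>V i. H (x, 0) = x) \<and> (\<lambda>x. H (x, 1)) constant_on V i \<and>
          (\<forall>x\<in>V i. semi_transversal X A Z (\<lambda>t. H (x, t))))" if "i < k" for i
    proof
      from U that obtain s
        where Ui: "openin (prod_topology X X) (U i)"
          and s: "continuous_map (subtopology (prod_topology X X) (U i)) (path_space X) s"
          and sU: "\<And>z. z \<in> U i \<Longrightarrow> endpoints (s z) = z \<and> semi_transversal X A Z (s z)"
        by blast
      show "openin X (V i)"
        unfolding V_def using slice Ui by (rule openin_continuous_map_preimage)
      have "continuous_map (subtopology X (V i)) (subtopology (prod_topology X X) (U i)) (\<lambda>x. (x, y))"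
        using slice by (auto simp: continuous_map_in_subtopology V_def
            intro: continuous_map_from_subtopology)
      from continuous_map_compose[OF this s]
      have sV: "continuous_map (subtopology X (V i)) (path_space X) (\<lambda>x. s (x, y))"
        by (simp add: o_def)
      \<comment> \<open>Uncurrying: the product of the restricted section with the identity,
        followed by evaluation.\<close>
      have "continuous_map (prod_topology (subtopology X (V i)) (top_of_set {0..1}))
          (prod_topology (path_space X) (top_of_set {0..1::real})) (\<lambda>(x, t). (s (x, y), t))"
        using sV by (simp add: continuous_map_prod_top)
      from continuous_map_compose[OF this continuous_map_path_space_eval]
      have "continuous_map (prod_topology (subtopology X (V i)) (top_of_set {0..1})) X
          (\<lambda>(x, t). s (x, y) t)"
        by (simp add: o_def case_prod_unfold)
      then show "\<exists>H. continuous_map (prod_topology (subtopology X (V i)) (top_of_set {0..1})) X H \<and>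
          (\<forall>x\<in>V i. H (x, 0) = x) \<and> (\<lambda>x. H (x, 1)) constant_on V i \<and>
          (\<forall>x\<in>V i. semi_transversal X A Z (\<lambda>t. H (x, t)))"
        \<comment> \<open>\<open>endpoints\<close> gives the values \<open>x\<close> at time 0 and
          \<open>y\<close> at time 1; the latter is the same for all \<open>x\<close>.\<close>
        using sU by (intro exI[of _ "\<lambda>(x, t). s (x, y) t"])
          (auto simp: V_def endpoints_def constant_on_def)
    qed
    ultimately show ?thesis by blast
  qed
qed

end
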